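(* Let $p\equiv 3\pmod 4$ be prime, and let $r\ge 1$ be an integer. Then there exists a set $S\subseteq[pr]^3$ with $|S|=p^2r^3$ such that \[ t(S)\ll p^2r^6 . \]
   Context: $[n]$ denotes the set $\{1,\dots,n\}$ of the first $n$ positive integers, and $[n]^3\subset\mathbb R^3$ is the corresponding grid. For a finite set $S\subset\mathbb R^3$, $t(S)$ denotes the number of collinear triples in $S$, i.e. the number of three-element subsets of $S$ all of whose elements lie on a common line in $\mathbb R^3$. The notation $X\ll Y$ means $X\le CY$ for some absolute constant $C>0$ (here independent of $p$ and $r$). *)

theory Defs
  imports "HOL-Analysis.Analysis" "HOL-Computational_Algebra.Primes"
begin

definition grid3 :: "nat \<Rightarrow> (real ^ 3) set"
  where "grid3 n = {x. \<forall>i. \<exists>k\<in>{1..n}. x $ i = real k}"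

(* Triples are unordered and consist of three distinct points.
   Meaningful for finite S only, since card is 0 on infinite sets. *)
definition collinear_triple_count :: "(real ^ 3) set \<Rightarrow> nat"
  where "collinear_triple_count S = card {T. T \<subseteq> S \<and> card T = 3 \<and> collinear T}"

end

theory Submission
  imports Defs "HOL-Number_Theory.Residues"
begin

text \<open>
  The set is the lift to \<open>[pr]\<^sup>3\<close> of the paraboloid \<open>x\<^sub>3 = x\<^sub>1\<^sup>2 + x\<^sub>2\<^sup>2\<close> over the field with \<open>p\<close>
  elements. A third coordinate is determined modulo \<open>p\<close> by the first two, so the lift has
  \<open>(pr)\<^sup>2 \<cdot> r\<close> points (\<open>card_mod_paraboloid\<close>).

  Every line through two lattice points consists, as far as lattice points are concerned, of the
  points \<open>x + s v\<close> with \<open>s\<close> an integer and \<open>v\<close> a primitive vector. Substituting into the equation of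
  the paraboloid gives a quadratic polynomial in \<open>s\<close> with leading coefficient
  \<open>v\<^sub>1\<^sup>2 + v\<^sub>2\<^sup>2\<close>. Because \<open>-1\<close> is not a square modulo \<open>p\<close>, this coefficient vanishes only if
  \<open>v\<close> is vertical modulo \<open>p\<close>, and then the linear coefficient does not vanish. Hence the parameters
  of the points of the set on the line lie in at most two residue classes modulo \<open>p\<close>
  (\<open>paraboloid_line_residues\<close>).

  Among three points on a line two therefore have parameters that differ by at least \<open>p\<close>. As the
  coordinates differ by less than \<open>pr\<close>, the height \<open>m\<close> of the direction \<open>v\<close>, its largest
  coordinate in absolute value, satisfies \<open>m < r\<close> (\<open>height_lt_of_three_params\<close>), and by the same token the line contains only \<open>O(r/m)\<close>
  points of the set (\<open>card_line_params_le\<close>). For a fixed base point and direction there are thus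
  \<open>O(r\<^sup>2/m\<^sup>2)\<close> triples; there are \<open>O(m\<^sup>2)\<close> directions of height \<open>m\<close>, so each height contributes
  \<open>O(r\<^sup>2)\<close>, and all heights below \<open>r\<close> together \<open>O(r\<^sup>3)\<close>. Multiplying by the number
  \<open>p\<^sup>2 r\<^sup>3\<close> of base points gives the bound \<open>O(p\<^sup>2 r\<^sup>6)\<close>.
\<close>

section \<open>Sums of two squares modulo a prime congruent to 3 modulo 4\<close>

text \<open>
  If \<open>p\<close> divided \<open>a\<^sup>2 + b\<^sup>2\<close> but not both terms, then \<open>a\<^sup>2\<close> and \<open>-b\<^sup>2\<close> would agree modulo \<open>p\<close>;
  raising to the odd power \<open>(p - 1)/2\<close> and using Fermat's little theorem would give \<open>1 = -1\<close>.
\<close>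
lemma prime_3_mod_4_dvd_sum_squares:
  fixes p :: nat and a b :: int
  assumes p: "prime p" "p mod 4 = 3" and dvd: "int p dvd a\<^sup>2 + b\<^sup>2"
  shows "int p dvd a \<and> int p dvd b"
proof (rule ccontr)
  assume not_both: "\<not> ?thesis"
  have pp: "prime (int p)" using p by simp
  have fermat: "[x ^ (p - 1) = 1] (mod int p)" if "\<not> int p dvd x" for x :: int
  proof -
    have "\<not> p dvd nat \<bar>x\<bar>" using that by (simp add: int_dvd_int_iff[symmetric])
    from fermat_theorem[OF p(1) this] have "[int (nat \<bar>x\<bar> ^ (p - 1)) = int 1] (mod int p)"
      by (simp only: cong_int_iff)
    moreover have "even (p - 1)" using p(2) by presburger
    ultimately show ?thesis by (simp add: power_even_abs)
  qed
  have "int p dvd a \<longleftrightarrow> int p dvd b"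
  proof -
    have "int p dvd a\<^sup>2 \<longleftrightarrow> int p dvd b\<^sup>2"
      using dvd dvd_add_left_iff dvd_add_right_iff by blast
    then show ?thesis using pp by (simp add: prime_dvd_power_iff)
  qed
  with not_both have ndvd: "\<not> int p dvd a" "\<not> int p dvd b" by auto
  define k where "k = (p - 1) div 2"
  have k: "p - 1 = 2 * k" and odd_k: "odd k" using p(2) unfolding k_def by presburger+
  have "[a\<^sup>2 = - (b\<^sup>2)] (mod int p)" using dvd by (simp add: cong_iff_dvd_diff)
  then have "[(a\<^sup>2) ^ k = (- (b\<^sup>2)) ^ k] (mod int p)" by (rule cong_pow)
  then have "[a ^ (p - 1) = - (b ^ (p - 1))] (mod int p)"
    unfolding k power_mult using odd_k by simp
  then have "[1 = - (b ^ (p - 1))] (mod int p)"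
    using fermat[OF ndvd(1)] cong_sym cong_trans by blast
  moreover have "[- (b ^ (p - 1)) = - 1] (mod int p)"
    using fermat[OF ndvd(2)] by (simp add: cong_minus_minus_iff)
  ultimately have "[1 = - 1] (mod int p)" by (rule cong_trans)
  then have "int p dvd 2" by (simp add: cong_iff_dvd_diff)
  then have "p dvd 2" by (simp flip: int_dvd_int_iff)
  then have "p \<le> 2" by (rule dvd_imp_le) simp
  then show False using p(2) by presburger
qed

section \<open>Primitive vectors and their height\<close>

lemma finite_card_box:
  fixes B :: "'n::finite \<Rightarrow> 'a set"
  assumes "\<And>i. finite (B i)"
  shows "finite {x :: 'a ^ 'n. \<forall>i. x $ i \<in> B i}"
    and "card {x :: 'a ^ 'n. \<forall>i. x $ i \<in> B i} = (\<Prod>i\<in>UNIV. card (B i))"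
proof -
  have bij: "bij_betw vec_nth {x :: 'a ^ 'n. \<forall>i. x $ i \<in> B i} (Pi\<^sub>E UNIV B)"
    by (rule bij_betwI[of _ _ _ vec_lambda]) (auto simp: vec_eq_iff)
  show "finite {x :: 'a ^ 'n. \<forall>i. x $ i \<in> B i}"
    using bij_betw_finite[OF bij] assms by (simp add: finite_PiE)
  show "card {x :: 'a ^ 'n. \<forall>i. x $ i \<in> B i} = (\<Prod>i\<in>UNIV. card (B i))"
    using bij_betw_same_card[OF bij] by (simp add: card_PiE)
qed

text \<open>
  Coprimality of the coordinates, in the form of a Bezout identity: this is the form in which it
  is used, both modulo \<open>p\<close> and to show that lattice points on a line have integer parameters.
\<close>
definition primitive :: "int ^ 'n::finite \<Rightarrow> bool"
  where "primitive v \<longleftrightarrow> (\<exists>b. (\<Sum>i\<in>UNIV. b $ i * v $ i) = 1)"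

definition height :: "int ^ 'n::finite \<Rightarrow> nat"
  where "height v = Max (range (\<lambda>i. nat \<bar>v $ i\<bar>))"

lemma coord_le_height: "\<bar>v $ i\<bar> \<le> int (height v)"
proof -
  have "nat \<bar>v $ i\<bar> \<le> height v" unfolding height_def by (rule Max_ge) auto
  then show ?thesis by simp
qed

lemma height_attained: "\<exists>i. \<bar>v $ i\<bar> = int (height v)"
proof -
  have "height v \<in> range (\<lambda>i. nat \<bar>v $ i\<bar>)" unfolding height_def by (rule Max_in) auto
  then show ?thesis by auto
qed

lemma primitive_height_pos:
  assumes "primitive v"
  shows "0 < height v"
proof (rule ccontr)
  assume "\<not> ?thesis"
  then have "v $ i = 0" for i using coord_le_height[of v i] by simp
  then show False using assms unfolding primitive_def by simp
qed

lemma primitive_not_all_dvd: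
  assumes "primitive v" "\<not> is_unit q"
  shows "\<exists>i. \<not> q dvd v $ i"
proof (rule ccontr)
  assume all_dvd: "\<not> ?thesis"
  obtain b where b: "(\<Sum>i\<in>UNIV. b $ i * v $ i) = 1"
    using assms unfolding primitive_def by auto
  have "q dvd (\<Sum>i\<in>UNIV. b $ i * v $ i)" using all_dvd by (intro dvd_sum dvd_mult) simp
  then have "q dvd 1" unfolding b .
  then show False using assms(2) by simp
qed

lemma primitive_direction:
  fixes d :: "int ^ 3"
  assumes "d \<noteq> 0"
  shows "\<exists>v g. primitive v \<and> g \<noteq> 0 \<and> d = g *s v"
proof -
  obtain a b where ab: "a * d $ 2 + b * d $ 3 = gcd (d $ 2) (d $ 3)" 
    using bezout_int by blast
  define g where "g = gcd (d $ 1) (gcd (d $ 2) (d $ 3))"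
  obtain a' b' where ab': "a' * d $ 1 + b' * gcd (d $ 2) (d $ 3) = g"
    unfolding g_def using bezout_int by blast
  have g0: "g \<noteq> 0" using assms unfolding g_def by (simp add: vec_eq_iff forall_3)
  have "g dvd d $ i" for i
    using exhaust_3[of i] unfolding g_def by (auto intro: dvd_trans[OF gcd_dvd2])
  then have d: "d $ i = g * (d $ i div g)" for i by simp
  define v :: "int ^ 3" where "v = (\<chi> i. d $ i div g)"
  have dv: "d = g *s v" using d by (simp add: vec_eq_iff v_def)
  have "g * (a' * v $ 1 + b' * a * v $ 2 + b' * b * v $ 3) = g * 1"
    using ab' unfolding ab[symmetric] by (simp add: dv algebra_simps)
  then have "a' * v $ 1 + b' * a * v $ 2 + b' * b * v $ 3 = 1"
    using g0 mult_left_cancel by blast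
  then have "primitive v"
    unfolding primitive_def sum_3
    by (intro exI[of _ "vector [a', b' * a, b' * b]"]) simp
  then show ?thesis using g0 dv by blast
qed

text \<open>
  The hypothesis says that \<open>u\<close> and \<open>v\<close> are parallel over the rationals. Weighting it with the
  Bezout coefficients of \<open>v\<close> exhibits the factor as an integer combination of the coordinates
  of \<open>u\<close>.
\<close>
lemma multiple_of_primitive:
  fixes u v :: "int ^ 'n::finite"
  assumes "primitive v" and par: "\<And>i j. u $ i * v $ j = u $ j * v $ i"
  shows "\<exists>t. u = t *s v"
proof -
  obtain b where b: "(\<Sum>j\<in>UNIV. b $ j * v $ j) = 1"
    using assms(1) unfolding primitive_def by auto
  have coord: "u $ i = (\<Sum>j\<in>UNIV. b $ j * u $ j) * v $ i" for i
  proof -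
    have "(\<Sum>j\<in>UNIV. b $ j * u $ j) * v $ i = (\<Sum>j\<in>UNIV. (b $ j * v $ j) * u $ i)"
      unfolding sum_distrib_right using par[of i] by (intro sum.cong) (auto simp: algebra_simps)
    also have "\<dots> = u $ i" by (simp add: b flip: sum_distrib_right)
    finally show ?thesis by simp
  qed
  show ?thesis unfolding vec_eq_iff vector_smult_component using coord by blast
qed

text \<open>
  The vectors of height \<open>m\<close> form the surface of a cube, which is covered by its six faces, each
  with \<open>(2m + 1)\<^sup>2 \<le> 9 m\<^sup>2\<close> lattice points.
\<close>
lemma card_height_shell_le:
  assumes "1 \<le> m"
  shows "finite {v :: int ^ 3. height v = m}" and "card {v :: int ^ 3. height v = m} \<le> 54 * m\<^sup>2"
proof -
  (* The box F i is the union of the two opposite faces on which coordinate i is extremal. *)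
  define B where "B i j = (if j = i then {- int m, int m} else {- int m..int m})" for i j :: 3
  define F where "F i = {v :: int ^ 3. \<forall>j. v $ j \<in> B i j}" for i
  have fin: "finite (F i)" for i unfolding F_def by (rule finite_card_box) (simp add: B_def)
  have sub: "{v :: int ^ 3. height v = m} \<subseteq> (\<Union>i\<in>UNIV. F i)"
  proof
    fix v :: "int ^ 3" assume "v \<in> {v. height v = m}"
    then have v: "height v = m" by simp
    obtain i where i: "\<bar>v $ i\<bar> = int m" using height_attained[of v] v by auto
    have "v $ j \<in> B i j" for j
      using i coord_le_height[of v j] v unfolding B_def by auto
    then show "v \<in> (\<Union>i\<in>UNIV. F i)" unfolding F_def by auto
  qed
  show "finite {v :: int ^ 3. height v = m}" by (rule finite_subset[OF sub]) (simp add: fin)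
  have cB: "card (B i j) = (if j = i then 2 else 2 * m + 1)" for i j
    using assms by (auto simp: B_def)
  have cF: "card (F i) = 2 * (2 * m + 1)\<^sup>2" for i
  proof -
    have "card (F i) = (\<Prod>j\<in>UNIV. card (B i j))"
      unfolding F_def by (rule finite_card_box) (simp add: B_def)
    also have "\<dots> = card (B i i) * (\<Prod>j\<in>UNIV - {i}. card (B i j))"
      by (rule prod.remove) auto
    also have "(\<Prod>j\<in>UNIV - {i}. card (B i j)) = (\<Prod>j\<in>UNIV - {i}. 2 * m + 1)"
      by (rule prod.cong) (auto simp: cB)
    also have "\<dots> = (2 * m + 1)\<^sup>2" by (simp add: card_Diff_singleton)
    finally show ?thesis by (simp add: cB)
  qed
  have "card {v :: int ^ 3. height v = m} \<le> card (\<Union>i\<in>UNIV. F i)"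
    by (rule card_mono[OF _ sub]) (simp add: fin)
  also have "\<dots> \<le> (\<Sum>i\<in>UNIV. card (F i))" by (rule card_UN_le) simp
  also have "\<dots> = 6 * (2 * m + 1)\<^sup>2" by (simp add: cF)
  also have "\<dots> \<le> 6 * (3 * m)\<^sup>2" using assms by (intro mult_left_mono power_mono) auto
  finally show "card {v :: int ^ 3. height v = m} \<le> 54 * m\<^sup>2" by (simp add: power2_eq_square)
qed

section \<open>The paraboloid modulo p in the grid\<close>

definition mod_paraboloid :: "nat \<Rightarrow> nat \<Rightarrow> (int ^ 3) set"
  where "mod_paraboloid p n =
    {x. (\<forall>i. x $ i \<in> {1..int n}) \<and> int p dvd (x $ 1)\<^sup>2 + (x $ 2)\<^sup>2 - x $ 3}"

lemma finite_mod_paraboloid: "finite (mod_paraboloid p n)"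
  by (rule finite_subset[OF _ finite_card_box(1)[of "\<lambda>_. {1..int n}"]])
    (auto simp: mod_paraboloid_def)

lemma le_int_div_iff:
  fixes m n q :: int
  assumes "0 < q"
  shows "n \<le> m div q \<longleftrightarrow> n * q \<le> m"
proof
  assume "n \<le> m div q"
  then have "n * q \<le> (m div q) * q" using assms by (intro mult_right_mono) auto
  also have "\<dots> \<le> m"
    using assms div_mult_mod_eq[of m q] pos_mod_sign[of q m] by linarith
  finally show "n * q \<le> m" .
next
  assume "n * q \<le> m"
  then have "(n * q) div q \<le> m div q" using assms by (rule zdiv_mono1)
  then show "n \<le> m div q" using assms by simp
qed

lemma card_residue_class:
  assumes "0 < p"
  shows "card {c \<in> {1..int (p * r)}. int p dvd k - c} = r"
proof -
  (* Since the interval starts at 1, division with remainder is applied to c - 1. *)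
  define f where "f j = int p * j + (k - 1) mod int p + 1" for j
  have inj: "inj_on f {0..<int r}" using assms by (auto simp: inj_on_def f_def)
  have "f ` {0..<int r} = {c \<in> {1..int (p * r)}. int p dvd k - c}"
  proof (intro subset_antisym subsetI)
    fix c assume "c \<in> f ` {0..<int r}"
    then obtain j where j: "0 \<le> j" "j < int r" and c: "c = f j" by auto
    have m: "0 \<le> (k - 1) mod int p" "(k - 1) mod int p < int p" using assms by auto
    have "int p * j \<le> int p * (int r - 1)" using j by (intro mult_left_mono) auto
    then have "c \<le> int (p * r)" using m unfolding c f_def by (simp add: algebra_simps)
    moreover have "1 \<le> c" using j m unfolding c f_def by simp
    moreover have "int p dvd k - c"
    proof -
      have "k - c = (k - 1) - (k - 1) mod int p - int p * j" unfolding c f_def by simp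
      then show ?thesis by (simp only: dvd_diff dvd_minus_mod dvd_triv_left)
    qed
    ultimately show "c \<in> {c \<in> {1..int (p * r)}. int p dvd k - c}" by simp
  next
    fix c assume "c \<in> {c \<in> {1..int (p * r)}. int p dvd k - c}"
    then have c: "1 \<le> c" "c \<le> int (p * r)" and d: "int p dvd k - c" by auto
    have "(k - 1) mod int p = (c - 1) mod int p"
      using d by (simp add: mod_eq_dvd_iff)
    then have "c = f ((c - 1) div int p)" unfolding f_def by simp
    moreover have "(c - 1) div int p \<in> {0..<int r}"
    proof -
      have "\<not> int r \<le> (c - 1) div int p"
        using c assms by (simp add: le_int_div_iff algebra_simps)
      then show ?thesis using c assms by (simp add: pos_imp_zdiv_nonneg_iff)
    qed
    ultimately show "c \<in> f ` {0..<int r}" by blast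
  qed
  then have "card {c \<in> {1..int (p * r)}. int p dvd k - c} = card (f ` {0..<int r})" by simp
  also have "\<dots> = r" using card_image[OF inj] by simp
  finally show ?thesis .
qed

lemma card_mod_paraboloid:
  assumes "0 < p"
  shows "card (mod_paraboloid p (p * r)) = p\<^sup>2 * r ^ 3"
proof -
  define I where "I = {1..int (p * r)}"
  have finI: "finite I" unfolding I_def by simp
  have cardI: "card I = p * r" unfolding I_def by (simp del: of_nat_mult)
  define A where "A = Sigma (I \<times> I) (\<lambda>(a, b). {c \<in> I. int p dvd a\<^sup>2 + b\<^sup>2 - c})"
  have "bij_betw (\<lambda>((a, b), c). vector [a, b, c] :: int ^ 3) A (mod_paraboloid p (p * r))"
    by (rule bij_betwI[of _ _ _ "\<lambda>x. ((x $ 1, x $ 2), x $ 3)"])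
      (auto simp: A_def I_def mod_paraboloid_def forall_3 vec_eq_iff)
  then have "card (mod_paraboloid p (p * r)) = card A" by (metis bij_betw_same_card)
  also have "\<dots> = (\<Sum>(a, b)\<in>I \<times> I. card {c \<in> I. int p dvd a\<^sup>2 + b\<^sup>2 - c})"
    unfolding A_def using finI by (subst card_SigmaI) (auto simp: case_prod_unfold)
  also have "\<dots> = (\<Sum>_\<in>I \<times> I. r)"
    unfolding I_def card_residue_class[OF assms] by simp
  also have "\<dots> = p\<^sup>2 * r ^ 3"
    by (simp add: card_cartesian_product cardI power2_eq_square power3_eq_cube algebra_simps)
  finally show ?thesis .
qed

section \<open>Lines meeting the paraboloid\<close>

text \<open>
  For a point \<open>x\<close> of the paraboloid, the equation for \<open>x + s v\<close> becomes \<open>s (s q + b) = 0\<close> modulo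
  \<open>p\<close>. The factor \<open>s\<close> gives the residue \<open>0\<close>; the other factor has at most one root modulo \<open>p\<close>, for
  if \<open>p\<close> divides \<open>q = v\<^sub>1\<^sup>2 + v\<^sub>2\<^sup>2\<close>, it divides \<open>v\<^sub>1\<close> and \<open>v\<^sub>2\<close>, and a root would force it to divide
  \<open>v\<^sub>3\<close> as well, which is impossible for a primitive vector.
\<close>
lemma paraboloid_line_residues:
  fixes x v :: "int ^ 3"
  assumes p: "prime p" "p mod 4 = 3" and v: "primitive v"
    and x: "int p dvd (x $ 1)\<^sup>2 + (x $ 2)\<^sup>2 - x $ 3"
  obtains c where "\<And>s. int p dvd
      ((x + s *s v) $ 1)\<^sup>2 + ((x + s *s v) $ 2)\<^sup>2 - (x + s *s v) $ 3 \<Longrightarrow>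
      s mod int p = 0 \<or> s mod int p = c"
proof -
  have pp: "prime (int p)" using p by simp
  define q where "q = (v $ 1)\<^sup>2 + (v $ 2)\<^sup>2"
  define b where "b = 2 * (x $ 1 * v $ 1 + x $ 2 * v $ 2) - v $ 3"
  have factor: "int p dvd s \<or> int p dvd s * q + b"
    if "int p dvd ((x + s *s v) $ 1)\<^sup>2 + ((x + s *s v) $ 2)\<^sup>2 - (x + s *s v) $ 3" for s
  proof -
    have "((x + s *s v) $ 1)\<^sup>2 + ((x + s *s v) $ 2)\<^sup>2 - (x + s *s v) $ 3
        = s * (s * q + b) + ((x $ 1)\<^sup>2 + (x $ 2)\<^sup>2 - x $ 3)"
      unfolding q_def b_def by (simp add: power2_eq_square algebra_simps)
    then have "int p dvd s * (s * q + b)" using that x dvd_add_left_iff by metis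
    then show ?thesis using pp by (simp add: prime_dvd_mult_iff)
  qed
  have unique: "s mod int p = t mod int p"
    if s: "int p dvd s * q + b" and t: "int p dvd t * q + b" for s t
  proof -
    have "\<not> int p dvd q"
    proof
      assume q: "int p dvd q"
      then have v12: "int p dvd v $ 1" "int p dvd v $ 2"
        using prime_3_mod_4_dvd_sum_squares[OF p q[unfolded q_def]] by blast+
      have "int p dvd b" using s dvd_add_right_iff[OF dvd_mult[OF q, of s], of b] by simp
      moreover have "int p dvd 2 * (x $ 1 * v $ 1 + x $ 2 * v $ 2)"
        using v12 by (intro dvd_mult dvd_add)
      ultimately have "int p dvd v $ 3" unfolding b_def by (simp only: dvd_diff_right_iff)
      with v12 have "int p dvd v $ i" for i using exhaust_3[of i] by auto
      moreover have "\<not> is_unit (int p)" using pp not_prime_unit by blast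
      ultimately show False using primitive_not_all_dvd[OF v] by blast
    qed
    moreover have "int p dvd (s - t) * q"
      using dvd_diff[OF s t] by (simp add: algebra_simps)
    ultimately show ?thesis using pp by (simp add: prime_dvd_mult_iff mod_eq_dvd_iff)
  qed
  show thesis
  proof (cases "\<exists>t. int p dvd t * q + b")
    case True
    then obtain t where "int p dvd t * q + b" by auto
    then show thesis
      using that[of "t mod int p"] factor unique[of _ t] dvd_imp_mod_0[of "int p"] by blast
  next
    case False
    then show thesis using that[of 0] factor dvd_imp_mod_0[of "int p"] by blast
  qed
qed

definition line_params :: "nat \<Rightarrow> nat \<Rightarrow> int ^ 3 \<Rightarrow> int ^ 3 \<Rightarrow> int set"
  where "line_params p n x v = {s. x + s *s v \<in> mod_paraboloid p n}"

lemma line_params_two_residues: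
  assumes "prime p" "p mod 4 = 3" "primitive v" "x \<in> mod_paraboloid p n"
  obtains c where "\<And>s. s \<in> line_params p n x v \<Longrightarrow> s mod int p = 0 \<or> s mod int p = c"
proof -
  obtain c where c: "\<And>s. int p dvd
      ((x + s *s v) $ 1)\<^sup>2 + ((x + s *s v) $ 2)\<^sup>2 - (x + s *s v) $ 3 \<Longrightarrow>
      s mod int p = 0 \<or> s mod int p = c"
    using paraboloid_line_residues[OF assms(1-3), of x] assms(4)
    by (auto simp: mod_paraboloid_def)
  show thesis by (rule that, rule c) (simp add: line_params_def mod_paraboloid_def)
qed

lemma line_params_diff:
  assumes "s \<in> line_params p n x v" "t \<in> line_params p n x v"
  shows "\<bar>s - t\<bar> * int (height v) < int n"
proof -
  obtain i where i: "\<bar>v $ i\<bar> = int (height v)" using height_attained by blast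
  have "(x + s *s v) $ i \<in> {1..int n}" "(x + t *s v) $ i \<in> {1..int n}"
    using assms unfolding line_params_def mod_paraboloid_def by blast+
  then have "\<bar>s * v $ i - t * v $ i\<bar> < int n" by (simp add: abs_less_iff)
  then have "\<bar>(s - t) * v $ i\<bar> < int n" by (simp only: left_diff_distrib)
  then show ?thesis unfolding abs_mult i .
qed

text \<open>
  The line already contains the point with parameter \<open>0\<close>, so a parameter \<open>s\<close> satisfies
  \<open>\<bar>s\<bar> m < p r\<close>, where \<open>m\<close> is the height of \<open>v\<close>. Writing \<open>q\<close> for the integer part of
  \<open>r/m\<close>, this leaves \<open>2 q + 2 \<le> 4 q\<close> values for the quotient of \<open>s\<close> by \<open>p\<close>, and there are at most
  two values for the remainder.
\<close>
lemma card_line_params_le: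
  assumes p: "prime p" "p mod 4 = 3" and v: "primitive v"
    and x: "x \<in> mod_paraboloid p (p * r)" and h: "height v < r"
  shows "finite (line_params p (p * r) x v)"
    and "card (line_params p (p * r) x v) \<le> 8 * (r div height v)"
proof -
  define L where "L = line_params p (p * r) x v"
  define m where "m = height v"
  define q where "q = r div m"
  have p0: "0 < p" using p(1) by (rule prime_gt_0_nat)
  have m: "0 < m" "m < r" using primitive_height_pos[OF v] h unfolding m_def by auto
  have q1: "1 \<le> q" using m unfolding q_def by (simp add: div_greater_zero_iff Suc_le_eq)
  have "r < m * (q + 1)" using m dividend_less_times_div[of m r] unfolding q_def by simp
  then have rq: "int r < int m * (int q + 1)" by (metis of_nat_1 of_nat_add of_nat_less_iff of_nat_mult)
  obtain c where c: "\<And>s. s \<in> L \<Longrightarrow> s mod int p = 0 \<or> s mod int p = c"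
    using line_params_two_residues[OF p v x] unfolding L_def by blast
  have zero: "0 \<in> L" using x unfolding L_def line_params_def by simp
  define D where "D = {- (int q + 1)..int q} \<times> {0, c}"
  have sub: "(\<lambda>s. (s div int p, s mod int p)) ` L \<subseteq> D"
  proof
    fix z assume "z \<in> (\<lambda>s. (s div int p, s mod int p)) ` L"
    then obtain s where s: "s \<in> L" and z: "z = (s div int p, s mod int p)" by auto
    have "\<bar>s\<bar> * int m < int p * int r"
      using line_params_diff[of s p "p * r" x v 0] s zero unfolding L_def m_def by simp
    also have "\<dots> < int p * (int m * (int q + 1))"
      using rq p0 by (intro mult_strict_left_mono) auto
    finally have "\<bar>s\<bar> * int m < (int p * (int q + 1)) * int m" by (simp add: algebra_simps)
    then have s1: "\<bar>s\<bar> < int p * (int q + 1)" using m by (simp add: mult_less_cancel_right)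
    have "\<not> int q + 1 \<le> s div int p"
      using s1 p0 by (simp add: le_int_div_iff algebra_simps)
    moreover have "- (int q + 1) \<le> s div int p"
      using s1 p0 by (subst le_int_div_iff) (auto simp: algebra_simps)
    ultimately show "z \<in> D" using c[OF s] unfolding z D_def by auto
  qed
  have inj: "inj_on (\<lambda>s. (s div int p, s mod int p)) L"
    by (rule inj_onI) (metis Pair_inject div_mult_mod_eq)
  have finD: "finite D" unfolding D_def by simp
  show "finite (line_params p (p * r) x v)"
    using inj_on_finite[OF inj sub finD] unfolding L_def .
  have "card L \<le> card D" by (rule card_inj_on_le[OF inj sub finD])
  also have "\<dots> = (2 * q + 2) * card {0, c}"
    unfolding D_def card_cartesian_product by (simp add: nat_add_distrib algebra_simps)
  also have "\<dots> \<le> (2 * q + 2) * 2" by (intro mult_left_mono) (auto simp: card_insert_if)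
  also have "\<dots> \<le> 8 * q" using q1 by simp
  finally show "card (line_params p (p * r) x v) \<le> 8 * (r div height v)"
    unfolding L_def q_def m_def .
qed

text \<open>
  By the pigeonhole principle two of the three parameters \<open>0\<close>, \<open>s\<close>, \<open>t\<close> lie in the same residue
  class modulo \<open>p\<close>, so they differ by at least \<open>p\<close>, while the corresponding points differ by less
  than \<open>p r\<close> in each coordinate.
\<close>
lemma height_lt_of_three_params:
  assumes p: "prime p" "p mod 4 = 3" and v: "primitive v"
    and x: "x \<in> mod_paraboloid p (p * r)"
    and st: "s \<in> line_params p (p * r) x v" "t \<in> line_params p (p * r) x v"
    and ne: "s \<noteq> 0" "t \<noteq> 0" "s \<noteq> t"
  shows "height v < r"
proof -
  have p0: "0 < p" using p(1) by (rule prime_gt_0_nat)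
  obtain c where c: "\<And>s. s \<in> line_params p (p * r) x v \<Longrightarrow> s mod int p = 0 \<or> s mod int p = c"
    using line_params_two_residues[OF p v x] by blast
  have zero: "0 \<in> line_params p (p * r) x v" using x unfolding line_params_def by simp
  have key: "height v < r"
    if a: "a \<in> line_params p (p * r) x v" and b: "b \<in> line_params p (p * r) x v"
      and ab: "a \<noteq> b" "a mod int p = b mod int p" for a b
  proof -
    have "int p dvd a - b" using ab(2) by (simp add: mod_eq_dvd_iff)
    then have "int p \<le> \<bar>a - b\<bar>" using ab(1) by (simp add: zdvd_imp_le)
    then have "int p * int (height v) \<le> \<bar>a - b\<bar> * int (height v)"
      by (rule mult_right_mono) simp
    also have "\<dots> < int p * int r" using line_params_diff[OF a b] by simp
    finally show ?thesis using p0 by simp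
  qed
  consider "s mod int p = 0" | "t mod int p = 0" | "s mod int p = t mod int p"
    using c[OF st(1)] c[OF st(2)] by argo
  then show ?thesis
  proof cases
    case 1
    then show ?thesis using key[OF st(1) zero] ne(1) by simp
  next
    case 2
    then show ?thesis using key[OF st(2) zero] ne(2) by simp
  next
    case 3
    then show ?thesis using key[OF st ne(3)] by simp
  qed
qed

section \<open>Counting collinear triples\<close>

definition real_vec :: "int ^ 3 \<Rightarrow> real ^ 3"
  where "real_vec x = (\<chi> i. real_of_int (x $ i))"

lemma inj_real_vec: "inj real_vec"
  by (auto simp: inj_on_def real_vec_def vec_eq_iff)

lemma collinear_lattice_points:
  assumes "collinear {real_vec x, real_vec y, real_vec z}" "x \<noteq> y"
  shows "\<exists>v s t. primitive v \<and> y = x + s *s v \<and> z = x + t *s v"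
proof -
  obtain w where w: "\<And>a b. a \<in> {real_vec x, real_vec y, real_vec z} \<Longrightarrow>
      b \<in> {real_vec x, real_vec y, real_vec z} \<Longrightarrow> \<exists>c. a - b = c *\<^sub>R w"
    using assms(1) unfolding collinear_def by blast
  obtain c where c: "real_vec y - real_vec x = c *\<^sub>R w" using w by blast
  obtain d where d: "real_vec z - real_vec x = d *\<^sub>R w" using w by blast
  have cc: "real_of_int ((y - x) $ i) = c * w $ i" for i
    using arg_cong[OF c, of "\<lambda>u. u $ i"] by (simp add: real_vec_def)
  have dd: "real_of_int ((z - x) $ i) = d * w $ i" for i
    using arg_cong[OF d, of "\<lambda>u. u $ i"] by (simp add: real_vec_def)
  (* Both differences are multiples of w, so their cross terms agree, and they are integers. *)
  have par: "(z - x) $ i * (y - x) $ j = (z - x) $ j * (y - x) $ i" for i j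
  proof -
    have "real_of_int ((z - x) $ i * (y - x) $ j) = real_of_int ((z - x) $ j * (y - x) $ i)"
      unfolding of_int_mult cc dd by simp
    then show ?thesis by (simp only: of_int_eq_iff)
  qed
  obtain v g where v: "primitive v" and g: "g \<noteq> 0" "y - x = g *s v"
    using primitive_direction[of "y - x"] assms(2) by auto
  have "(z - x) $ i * v $ j = (z - x) $ j * v $ i" for i j
  proof -
    have "g * ((z - x) $ i * v $ j) = g * ((z - x) $ j * v $ i)"
      using par[of i j] unfolding g(2) by (simp add: mult.left_commute)
    then show ?thesis using g(1) mult_left_cancel by blast
  qed
  then obtain t where t: "z - x = t *s v" using multiple_of_primitive[OF v] by blast
  show ?thesis
  proof (intro exI conjI)
    show "primitive v" by (rule v)
    show "y = x + g *s v" unfolding g(2)[symmetric] by simp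
    show "z = x + t *s v" unfolding t[symmetric] by simp
  qed
qed

text \<open>
  Each collinear triple has the form \<open>{x, x + s v, x + t v}\<close> with \<open>v\<close> primitive of height below
  \<open>r\<close>, any of its points serving as \<open>x\<close>. The right-hand side counts all \<open>(x, v, s, t)\<close>, so it
  counts every triple several times and includes degenerate choices such as \<open>s = t\<close>.
\<close>
lemma collinear_triple_count_le:
  assumes p: "prime p" "p mod 4 = 3"
  shows "collinear_triple_count (real_vec ` mod_paraboloid p (p * r)) \<le>
    (\<Sum>x\<in>mod_paraboloid p (p * r). \<Sum>v | primitive v \<and> height v < r.
      (card (line_params p (p * r) x v))\<^sup>2)"
proof -
  define P where "P = mod_paraboloid p (p * r)"
  define V where "V = {v :: int ^ 3. primitive v \<and> height v < r}"
  define L where "L x v = line_params p (p * r) x v" for x v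
  define E where "E x v = (\<lambda>(s, t). real_vec ` {x, x + s *s v, x + t *s v}) ` (L x v \<times> L x v)"
    for x v
  have finP: "finite P" unfolding P_def by (rule finite_mod_paraboloid)
  have "V \<subseteq> (\<Union>m\<in>{1..<r}. {v. height v = m})"
    unfolding V_def using primitive_height_pos by (auto simp: Suc_le_eq)
  then have finV: "finite V" by (rule finite_subset) (auto intro!: finite_UN_I card_height_shell_le)
  have finL: "finite (L x v)" if "x \<in> P" "v \<in> V" for x v
    using card_line_params_le(1)[OF p] that unfolding L_def P_def V_def by auto
  have sub: "{T. T \<subseteq> real_vec ` P \<and> card T = 3 \<and> collinear T} \<subseteq> (\<Union>x\<in>P. \<Union>v\<in>V. E x v)"
  proof
    fix T assume "T \<in> {T. T \<subseteq> real_vec ` P \<and> card T = 3 \<and> collinear T}"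
    then have T: "T \<subseteq> real_vec ` P" "card T = 3" "collinear T" by auto
    obtain X Y Z where "T = {X, Y, Z}" and "X \<noteq> Y" "Y \<noteq> Z" "X \<noteq> Z"
      using T(2) unfolding card_3_iff by blast
    then obtain x y z where xyz: "x \<in> P" "y \<in> P" "z \<in> P" "x \<noteq> y" "y \<noteq> z" "x \<noteq> z"
      and Teq: "T = {real_vec x, real_vec y, real_vec z}"
      using T(1) by auto
    obtain v s t where v: "primitive v" and s: "y = x + s *s v" and t: "z = x + t *s v"
      using collinear_lattice_points[of x y z] T(3) xyz(4) unfolding Teq by blast
    have st: "s \<in> L x v" "t \<in> L x v"
      using xyz s t unfolding L_def line_params_def P_def by auto
    have "s \<noteq> 0" "t \<noteq> 0" "s \<noteq> t" using xyz s t by auto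
    then have "v \<in> V"
      using height_lt_of_three_params[OF p v, of x r s t] st xyz(1) v
      unfolding V_def P_def L_def by auto
    moreover have "T \<in> E x v"
      unfolding E_def Teq using st s t by (intro image_eqI[of _ _ "(s, t)"]) auto
    ultimately show "T \<in> (\<Union>x\<in>P. \<Union>v\<in>V. E x v)" using xyz(1) by blast
  qed
  have finE: "finite (\<Union>x\<in>P. \<Union>v\<in>V. E x v)"
    unfolding E_def by (intro finite_UN_I finP finV finite_imageI finite_cartesian_product finL)
  have cE: "card (E x v) \<le> (card (L x v))\<^sup>2" if "x \<in> P" "v \<in> V" for x v
  proof -
    have "card (E x v) \<le> card (L x v \<times> L x v)"
      unfolding E_def by (intro card_image_le finite_cartesian_product finL that)
    then show ?thesis by (simp add: card_cartesian_product power2_eq_square)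
  qed
  have "collinear_triple_count (real_vec ` P) \<le> card (\<Union>x\<in>P. \<Union>v\<in>V. E x v)"
    unfolding collinear_triple_count_def by (rule card_mono[OF finE sub])
  also have "\<dots> \<le> (\<Sum>x\<in>P. card (\<Union>v\<in>V. E x v))" by (rule card_UN_le[OF finP])
  also have "\<dots> \<le> (\<Sum>x\<in>P. \<Sum>v\<in>V. card (E x v))" by (intro sum_mono card_UN_le finV)
  also have "\<dots> \<le> (\<Sum>x\<in>P. \<Sum>v\<in>V. (card (L x v))\<^sup>2)" by (intro sum_mono cE)
  finally show ?thesis unfolding P_def V_def L_def .
qed

text \<open>
  The sum is grouped by the height \<open>m\<close> of \<open>v\<close>: at most \<open>54 m\<^sup>2\<close> vectors contribute at most
  \<open>(8 r/m)\<^sup>2\<close> each, hence \<open>54 \<cdot> 64 \<cdot> r\<^sup>2 = 3456 r\<^sup>2\<close> for each of fewer than \<open>r\<close> heights.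
\<close>
lemma sum_line_params_le:
  assumes p: "prime p" "p mod 4 = 3" and x: "x \<in> mod_paraboloid p (p * r)"
  shows "(\<Sum>v | primitive v \<and> height v < r. (card (line_params p (p * r) x v))\<^sup>2) \<le> 3456 * r ^ 3"
proof -
  define V where "V = {v :: int ^ 3. primitive v \<and> height v < r}"
  define H where "H m = {v :: int ^ 3. height v = m}" for m
  define N where "N v = card (line_params p (p * r) x v)" for v
  have V_sub: "V \<subseteq> (\<Union>m\<in>{1..<r}. H m)"
    unfolding V_def H_def using primitive_height_pos by (auto simp: Suc_le_eq)
  have finV: "finite V"
    by (rule finite_subset[OF V_sub]) (auto simp: H_def intro!: finite_UN_I card_height_shell_le)
  have shell: "(\<Sum>v | v \<in> V \<and> height v = m. (N v)\<^sup>2) \<le> 3456 * r\<^sup>2" if m: "m \<in> {1..<r}" for m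
  proof -
    have N: "(N v)\<^sup>2 \<le> (8 * (r div m))\<^sup>2" if "v \<in> V" "height v = m" for v
      using card_line_params_le(2)[OF p _ x, of v] that
      unfolding N_def V_def by (intro power_mono) auto
    have "(\<Sum>v | v \<in> V \<and> height v = m. (N v)\<^sup>2)
        \<le> card {v \<in> V. height v = m} * (8 * (r div m))\<^sup>2"
      using sum_bounded_above[of "{v \<in> V. height v = m}" "\<lambda>v. (N v)\<^sup>2"] N by simp
    also have "\<dots> \<le> (54 * m\<^sup>2) * (8 * (r div m))\<^sup>2"
    proof (rule mult_right_mono)
      have "card {v \<in> V. height v = m} \<le> card (H m)"
        using m unfolding H_def by (intro card_mono card_height_shell_le) auto
      also have "\<dots> \<le> 54 * m\<^sup>2" using m unfolding H_def by (intro card_height_shell_le) auto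
      finally show "card {v \<in> V. height v = m} \<le> 54 * m\<^sup>2" .
    qed simp
    also have "\<dots> = 3456 * (m * (r div m))\<^sup>2" by (simp add: power_mult_distrib)
    also have "\<dots> \<le> 3456 * r\<^sup>2" by (intro mult_left_mono power_mono) auto
    finally show ?thesis .
  qed
  have "(\<Sum>v\<in>V. (N v)\<^sup>2) = (\<Sum>m\<in>{1..<r}. \<Sum>v | v \<in> V \<and> height v = m. (N v)\<^sup>2)"
    by (rule sum.group[symmetric]) (use finV V_sub in \<open>auto simp: H_def\<close>)
  also have "\<dots> \<le> (\<Sum>m\<in>{1..<r}. 3456 * r\<^sup>2)" by (rule sum_mono[OF shell])
  also have "\<dots> \<le> r * (3456 * r\<^sup>2)" by (simp del: mult.assoc)
  also have "\<dots> = 3456 * r ^ 3" by (simp add: power2_eq_square power3_eq_cube)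
  finally show ?thesis unfolding V_def N_def .
qed

theorem theorem4:
  shows "\<exists>C::real. C > 0 \<and>
    (\<forall>(p::nat) (r::nat). prime p \<and> p mod 4 = 3 \<and> r \<ge> 1 \<longrightarrow>
      (\<exists>S. S \<subseteq> grid3 (p * r) \<and> card S = p ^ 2 * r ^ 3 \<and>
        real (collinear_triple_count S) \<le> C * (real p ^ 2 * real r ^ 6)))"
proof (rule exI[of _ 3456], intro conjI allI impI)
  fix p r :: nat
  assume "prime p \<and> p mod 4 = 3 \<and> r \<ge> 1"
  then have p: "prime p" "p mod 4 = 3" by auto
  define P where "P = mod_paraboloid p (p * r)"
  have cardP: "card P = p\<^sup>2 * r ^ 3"
    unfolding P_def using p(1) by (intro card_mod_paraboloid prime_gt_0_nat)
  have grid: "real_vec ` P \<subseteq> grid3 (p * r)"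
  proof
    fix y assume "y \<in> real_vec ` P"
    then obtain x where x: "x \<in> P" and y: "y = real_vec x" by auto
    have "\<exists>k\<in>{1..p * r}. y $ i = real k" for i
    proof (rule bexI)
      have "x $ i \<in> {1..int (p * r)}" using x unfolding P_def mod_paraboloid_def by blast
      then show "nat (x $ i) \<in> {1..p * r}" "y $ i = real (nat (x $ i))"
        unfolding y real_vec_def by (auto simp: nat_le_iff le_nat_iff)
    qed
    then show "y \<in> grid3 (p * r)" unfolding grid3_def by blast
  qed
  have "collinear_triple_count (real_vec ` P) \<le> (\<Sum>x\<in>P. 3456 * r ^ 3)"
    unfolding P_def
    by (rule order_trans[OF collinear_triple_count_le[OF p] sum_mono[OF sum_line_params_le[OF p]]])
  also have "\<dots> = 3456 * (p\<^sup>2 * r ^ 6)" by (simp add: cardP flip: power_add)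
  finally have "real (collinear_triple_count (real_vec ` P)) \<le> real (3456 * (p\<^sup>2 * r ^ 6))"
    by (rule of_nat_mono)
  then have "real (collinear_triple_count (real_vec ` P)) \<le> 3456 * (real p ^ 2 * real r ^ 6)"
    by simp
  moreover have "card (real_vec ` P) = p\<^sup>2 * r ^ 3"
    using card_image[OF inj_on_subset[OF inj_real_vec]] cardP by simp
  ultimately show "\<exists>S. S \<subseteq> grid3 (p * r) \<and> card S = p ^ 2 * r ^ 3 \<and>
      real (collinear_triple_count S) \<le> 3456 * (real p ^ 2 * real r ^ 6)"
    using grid by blast
qed simp

end
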